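(* In $L(\mathfrak{sl}_2)^+$ define, for $i\geq 0$, $$A^{\downarrow\downarrow}_i=-x\otimes(t-1)^i,\qquad B^{\downarrow\downarrow}_i=(-y\otimes t-z\otimes(t-1))(t-1)^i,\qquad \psi^{\downarrow\downarrow}_i=(-x\otimes1-y\otimes t)(t-1)^{i-1}.$$ Then the Onsager Lie algebra $O$ has a basis $$A^{\downarrow\downarrow}_i,\qquad B^{\downarrow\downarrow}_i,\qquad \psi^{\downarrow\downarrow}_{i+1},\qquad i\in\mathbb{N},$$ where $A^{\downarrow\downarrow}_0=-A$ and $B^{\downarrow\downarrow}_0=-B$. The Lie bracket acts on this basis as follows. For $i,j\in\mathbb{N}$, $$\begin{aligned} [A^{\downarrow\downarrow}_i,A^{\downarrow\downarrow}_j]&=0,\\ [B^{\downarrow\downarrow}_i,B^{\downarrow\downarrow}_j]&=0,\\ [\psi^{\downarrow\downarrow}_i,\psi^{\downarrow\downarrow}_j]&=0,\\ [\psi^{\downarrow\downarrow}_i,A^{\downarrow\downarrow}_j]&=2\psi^{\downarrow\downarrow}_{i+j}+2A^{\downarrow\downarrow}_{i+j},\\ [B^{\downarrow\downarrow}_i,\psi^{\downarrow\downarrow}_j]&=2B^{\downarrow\downarrow}_{i+j}+2\psi^{\downarrow\downarrow}_{i+j},\\ [A^{\downarrow\downarrow}_i,B^{\downarrow\downarrow}_j]&=2A^{\downarrow\downarrow}_{i+j}+2B^{\downarrow\downarrow}_{i+j}-4\psi^{\downarrow\downarrow}_{i+j+1}. \end{aligned}$$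
   Context: $\mathbb{F}$ is a field of characteristic zero; $\mathbb{N}=\{0,1,2,\ldots\}$; tensor products are over $\mathbb{F}$. $\mathfrak{sl}_2$ is the Lie algebra over $\mathbb{F}$ with basis $e,f,h$ and $[h,e]=2e$, $[h,f]=-2f$, $[e,f]=h$. Its equitable basis is $x=2e-h$, $y=-2f-h$, $z=h$, which satisfies $[x,y]=2x+2y$, $[y,z]=2y+2z$, $[z,x]=2z+2x$. Let $t$ be an indeterminate and $\mathcal{A}=\mathbb{F}[t,t^{-1},(t-1)^{-1}]$. The three-point $\mathfrak{sl}_2$ loop algebra $L(\mathfrak{sl}_2)^+$ is the vector space $\mathfrak{sl}_2\otimes\mathcal{A}$ with Lie bracket $[u\otimes a,v\otimes b]=[u,v]\otimes ab$. It is a right $\mathcal{A}$-module via $(u\otimes a)b=u\otimes ab$. The Onsager Lie algebra $O$ is the Lie algebra over $\mathbb{F}$ with generators $A,B$ and relations $[A,[A,[A,B]]]=4[A,B]$, $[B,[B,[B,A]]]=4[B,A]$. There is an injective Lie algebra homomorphism $O\to L(\mathfrak{sl}_2)^+$ with $A\mapsto x\otimes 1$, $B\mapsto y\otimes t+z\otimes(t-1)$, and $O$ is identified with its image; so $O$ is the Lie subalgebra of $L(\mathfrak{sl}_2)^+$ generated by $A=x\otimes1$ and $B=y\otimes t+z\otimes(t-1)$. The brackets in the claim are taken in $L(\mathfrak{sl}_2)^+$ (the element with index $0$ of the $\psi$ family does not lie in $O$). *)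

theory Defs
  imports
    Complex_Main
    "HOL-Computational_Algebra.Polynomial"
    "HOL-Computational_Algebra.Fraction_Field"
begin

section \<open>The algebra F[t, 1/t, 1/(t-1)]\<close>

text \<open>Realised as the localisation of the polynomial ring at \<open>t\<close> and \<open>t - 1\<close>, inside the field
  of rational functions.\<close>

typedef (overloaded) 'a three_pt =
  "{q :: 'a::field poly fract. \<exists>p i j. q = Fract p ([:0, 1:] ^ i * [:-1, 1:] ^ j)}"
  by blast

setup_lifting type_definition_three_pt

lemma fract_denom_nonzero [simp]: "[:0, 1:] ^ i * [:-1, 1:] ^ j \<noteq> (0 :: 'a::field poly)"
  by simp

instantiation three_pt :: (field) comm_ring_1
begin

lift_definition zero_three_pt :: "'a three_pt" is 0
  by (rule exI[of _ 0], rule exI[of _ 0], rule exI[of _ 0]) (simp add: Zero_fract_def)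

lift_definition one_three_pt :: "'a three_pt" is 1
  by (rule exI[of _ 1], rule exI[of _ 0], rule exI[of _ 0]) (simp add: One_fract_def)

lift_definition uminus_three_pt :: "'a three_pt \<Rightarrow> 'a three_pt" is uminus
  by (metis minus_fract)

lift_definition times_three_pt :: "'a three_pt \<Rightarrow> 'a three_pt \<Rightarrow> 'a three_pt" is "(*)"
proof -
  fix q r :: "'a poly fract"
  assume "\<exists>p i j. q = Fract p ([:0, 1:] ^ i * [:-1, 1:] ^ j)"
  then obtain p i j where q: "q = Fract p ([:0, 1:] ^ i * [:-1, 1:] ^ j)" by blast
  assume "\<exists>p i j. r = Fract p ([:0, 1:] ^ i * [:-1, 1:] ^ j)"
  then obtain p' i' j' where r: "r = Fract p' ([:0, 1:] ^ i' * [:-1, 1:] ^ j')" by blast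
  have "q * r = Fract (p * p') ([:0, 1:] ^ (i + i') * [:-1, 1:] ^ (j + j'))"
    unfolding q r mult_fract power_add by (simp only: ac_simps)
  then show "\<exists>p i j. q * r = Fract p ([:0, 1:] ^ i * [:-1, 1:] ^ j)" by blast
qed

lift_definition plus_three_pt :: "'a three_pt \<Rightarrow> 'a three_pt \<Rightarrow> 'a three_pt" is "(+)"
proof -
  fix q r :: "'a poly fract"
  assume "\<exists>p i j. q = Fract p ([:0, 1:] ^ i * [:-1, 1:] ^ j)"
  then obtain p i j where q: "q = Fract p ([:0, 1:] ^ i * [:-1, 1:] ^ j)" by blast
  assume "\<exists>p i j. r = Fract p ([:0, 1:] ^ i * [:-1, 1:] ^ j)"
  then obtain p' i' j' where r: "r = Fract p' ([:0, 1:] ^ i' * [:-1, 1:] ^ j')" by blast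
  have "q + r = Fract (p * ([:0, 1:] ^ i' * [:-1, 1:] ^ j') + p' * ([:0, 1:] ^ i * [:-1, 1:] ^ j))
      ([:0, 1:] ^ (i + i') * [:-1, 1:] ^ (j + j'))"
    unfolding q r add_fract[OF fract_denom_nonzero fract_denom_nonzero] power_add
    by (simp only: ac_simps)
  then show "\<exists>p i j. q + r = Fract p ([:0, 1:] ^ i * [:-1, 1:] ^ j)" by blast
qed

definition minus_three_pt :: "'a three_pt \<Rightarrow> 'a three_pt \<Rightarrow> 'a three_pt" where
  "minus_three_pt a b = a + - b"

instance
  by standard (simp add: minus_three_pt_def | transfer, simp add: algebra_simps)+

end

lift_definition scalar :: "'a::field \<Rightarrow> 'a three_pt" is "\<lambda>c. Fract [:c:] 1"
  by (metis mult_1_left power_0)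

lift_definition tvar :: "'a::field three_pt" is "Fract [:0, 1:] 1"
  by (metis mult_1_left power_0)

text \<open>The integer powers of the unit \<open>t - 1\<close>.\<close>

lift_definition tm1_powi :: "int \<Rightarrow> 'a::field three_pt" is "\<lambda>k. Fract [:-1, 1:] 1 powi k"
proof -
  fix k :: int
  define d where "d = [:-1, 1 :: 'a:]"
  have pow: "Fract p 1 ^ n = Fract (p ^ n) 1" "Fract 1 p ^ n = Fract 1 (p ^ n)"
    for p :: "'a poly" and n
    by (induction n) (simp_all add: One_fract_def mult_fract)
  have "Fract d 1 powi k = Fract (d ^ nat k) ([:0, 1:] ^ 0 * d ^ 0)" if "k \<ge> 0"
    using that by (simp add: power_int_def pow)
  moreover have "Fract d 1 powi k = Fract 1 ([:0, 1:] ^ 0 * d ^ nat (- k))" if "\<not> k \<ge> 0"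
    using that by (simp add: power_int_def pow)
  ultimately have "\<exists>p i j. Fract d 1 powi k = Fract p ([:0, 1:] ^ i * d ^ j)" by blast
  then show "\<exists>p i j. Fract [:-1, 1:] 1 powi k = Fract p ([:0, 1:] ^ i * [:-1, 1 :: 'a:] ^ j)"
    by (simp only: d_def)
qed

lemma scalar_simps [simp]:
  "scalar 0 = (0 :: 'a::field three_pt)" "scalar 1 = (1 :: 'a three_pt)"
  "scalar (c + d) = (scalar c + scalar d :: 'a three_pt)"
  "scalar (c * d) = (scalar c * scalar d :: 'a three_pt)"
     apply (transfer, simp add: Zero_fract_def)
    apply (transfer, simp add: One_fract_def one_pCons)
   apply (transfer, simp)
  apply (transfer, simp add: mult.commute)
  done

lemma tm1_powi_0: "tm1_powi 0 = (1 :: 'a::field three_pt)"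
  by transfer simp

lemma tm1_powi_1: "tm1_powi 1 = (tvar - 1 :: 'a::field three_pt)"
  unfolding minus_three_pt_def by transfer (simp add: One_fract_def one_pCons)

lemma tm1_powi_add: "tm1_powi (k + l) = (tm1_powi k * tm1_powi l :: 'a::field three_pt)"
proof -
  have "Fract [:-1, 1 :: 'a:] 1 \<noteq> 0"
    by (simp add: Zero_fract_def eq_fract)
  then show ?thesis
    by transfer (simp add: power_int_add)
qed


section \<open>The Lie algebra sl2 and its loop algebra\<close>

text \<open>Coordinates with respect to the basis \<open>e, f, h\<close>. Over the ground field this is sl2 itself;
  over \<open>F[t, 1/t, 1/(t-1)]\<close> it is the tensor product of sl2 with that algebra, as the universal
  property \<open>tensor_universal\<close> below confirms.\<close>

datatype 'r sl2 = SL2 (coord_e: 'r) (coord_f: 'r) (coord_h: 'r)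

instantiation sl2 :: (ab_group_add) ab_group_add
begin

definition zero_sl2 :: "'a sl2" where "0 = SL2 0 0 0"

definition plus_sl2 :: "'a sl2 \<Rightarrow> 'a sl2 \<Rightarrow> 'a sl2" where
  "X + Y = SL2 (coord_e X + coord_e Y) (coord_f X + coord_f Y) (coord_h X + coord_h Y)"

definition minus_sl2 :: "'a sl2 \<Rightarrow> 'a sl2 \<Rightarrow> 'a sl2" where
  "X - Y = SL2 (coord_e X - coord_e Y) (coord_f X - coord_f Y) (coord_h X - coord_h Y)"

definition uminus_sl2 :: "'a sl2 \<Rightarrow> 'a sl2" where
  "- X = SL2 (- coord_e X) (- coord_f X) (- coord_h X)"

instance
  by standard
    (simp_all add: zero_sl2_def plus_sl2_def minus_sl2_def uminus_sl2_def algebra_simps)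

end

definition smul :: "'r::comm_ring_1 \<Rightarrow> 'r sl2 \<Rightarrow> 'r sl2" where
  "smul r X = SL2 (r * coord_e X) (r * coord_f X) (r * coord_h X)"

definition bracket :: "'r::comm_ring_1 sl2 \<Rightarrow> 'r sl2 \<Rightarrow> 'r sl2"  ("\<lbrakk>_,/ _\<rbrakk>") where
  "\<lbrakk>X, Y\<rbrakk> = SL2
     (2 * (coord_h X * coord_e Y - coord_e X * coord_h Y))
     (- 2 * (coord_h X * coord_f Y - coord_f X * coord_h Y))
     (coord_e X * coord_f Y - coord_f X * coord_e Y)"

lemmas sl2_arith_defs =
  zero_sl2_def plus_sl2_def minus_sl2_def uminus_sl2_def smul_def bracket_def

definition sl2_e :: "'r::comm_ring_1 sl2" where "sl2_e = SL2 1 0 0"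
definition sl2_f :: "'r::comm_ring_1 sl2" where "sl2_f = SL2 0 1 0"
definition sl2_h :: "'r::comm_ring_1 sl2" where "sl2_h = SL2 0 0 1"

lemma sl2_basis_brackets:
  "\<lbrakk>sl2_h, sl2_e\<rbrakk> = smul 2 sl2_e" "\<lbrakk>sl2_h, sl2_f\<rbrakk> = smul (- 2) sl2_f" "\<lbrakk>sl2_e, sl2_f\<rbrakk> = sl2_h"
  by (simp_all add: sl2_arith_defs sl2_e_def sl2_f_def sl2_h_def)

lemma bracket_bilinear:
  "\<lbrakk>X + X', Y\<rbrakk> = \<lbrakk>X, Y\<rbrakk> + \<lbrakk>X', Y\<rbrakk>" "\<lbrakk>X, Y + Y'\<rbrakk> = \<lbrakk>X, Y\<rbrakk> + \<lbrakk>X, Y'\<rbrakk>"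
  "\<lbrakk>smul r X, Y\<rbrakk> = smul r \<lbrakk>X, Y\<rbrakk>" "\<lbrakk>X, smul r Y\<rbrakk> = smul r \<lbrakk>X, Y\<rbrakk>"
  by (simp_all add: sl2_arith_defs algebra_simps)

lemma bracket_alternating: "\<lbrakk>X, X\<rbrakk> = 0"
  by (simp add: sl2_arith_defs algebra_simps)

lemma bracket_jacobi: "\<lbrakk>X, \<lbrakk>Y, Z\<rbrakk>\<rbrakk> + \<lbrakk>Y, \<lbrakk>Z, X\<rbrakk>\<rbrakk> + \<lbrakk>Z, \<lbrakk>X, Y\<rbrakk>\<rbrakk> = 0"
  by (simp add: sl2_arith_defs algebra_simps)

definition sl2_x :: "'r::comm_ring_1 sl2" where "sl2_x = smul 2 sl2_e - sl2_h"
definition sl2_y :: "'r::comm_ring_1 sl2" where "sl2_y = smul (- 2) sl2_f - sl2_h"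
definition sl2_z :: "'r::comm_ring_1 sl2" where "sl2_z = sl2_h"

type_synonym 'a loop = "'a three_pt sl2"

definition tensor :: "'a::field sl2 \<Rightarrow> 'a three_pt \<Rightarrow> 'a loop"  (infix "\<otimes>" 75) where
  "u \<otimes> a = SL2 (scalar (coord_e u) * a) (scalar (coord_f u) * a) (scalar (coord_h u) * a)"

definition loop_scale :: "'a::field \<Rightarrow> 'a loop \<Rightarrow> 'a loop" where
  "loop_scale c X = smul (scalar c) X"

definition right_act :: "'a::field loop \<Rightarrow> 'a three_pt \<Rightarrow> 'a loop"  (infixl "\<cdot>" 72) where
  "X \<cdot> b = smul b X"

interpretation loop: vector_space loop_scale
  by standard (simp_all add: loop_scale_def sl2_arith_defs algebra_simps)

lemma scalar_minus [simp]: "scalar (- c) = - scalar c"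
  by transfer simp

lemma scalar_diff [simp]: "scalar (c - d) = scalar c - scalar d"
  by (simp add: minus_three_pt_def flip: scalar_simps scalar_minus)

lemma scalar_two [simp]: "scalar 2 = 2"
  by (metis scalar_simps(2,3) one_add_one)

lemma tensor_act: "(u \<otimes> a) \<cdot> b = u \<otimes> (a * b)"
  by (simp add: right_act_def tensor_def sl2_arith_defs algebra_simps)

lemma vector_space_sl2: "vector_space (smul :: 'a::field \<Rightarrow> 'a sl2 \<Rightarrow> 'a sl2)"
  by standard (simp_all add: sl2_arith_defs algebra_simps)

lemma vector_space_three_pt: "vector_space (\<lambda>(c :: 'a::field) (a :: 'a three_pt). scalar c * a)"
  by standard (simp_all add: algebra_simps)

lemma bracket_tensor: "\<lbrakk>u \<otimes> a, v \<otimes> b\<rbrakk> = \<lbrakk>u, v\<rbrakk> \<otimes> (a * b)"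
  by (simp add: tensor_def sl2_arith_defs algebra_simps)

lemma tensor_universal:
  fixes \<beta> :: "'a::field sl2 \<Rightarrow> 'a three_pt \<Rightarrow> 'b::ab_group_add"
  assumes vs: "vector_space s"
    and lin1: "\<And>a. Vector_Spaces.linear smul s (\<lambda>u. \<beta> u a)"
    and lin2: "\<And>u. Vector_Spaces.linear (\<lambda>c a. scalar c * a) s (\<beta> u)"
  shows "\<exists>!\<phi>. Vector_Spaces.linear loop_scale s \<phi> \<and> (\<forall>u a. \<phi> (u \<otimes> a) = \<beta> u a)"
proof -
  interpret s: vector_space s by (rule vs)
  have b1: "\<beta> (u + v) a = \<beta> u a + \<beta> v a" "\<beta> (smul c u) a = s c (\<beta> u a)" for u v a c
    using lin1[of a] by (simp_all add: Vector_Spaces.linear_iff)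
  have b2: "\<beta> u (a + b) = \<beta> u a + \<beta> u b" "\<beta> u (scalar c * a) = s c (\<beta> u a)" for u a b c
    using lin2[of u] by (simp_all add: Vector_Spaces.linear_iff)
  have u_dec: "u = smul (coord_e u) sl2_e + smul (coord_f u) sl2_f + smul (coord_h u) sl2_h"
    for u :: "'a sl2"
    by (simp add: sl2_e_def sl2_f_def sl2_h_def sl2_arith_defs)
  have X_dec: "X = sl2_e \<otimes> coord_e X + sl2_f \<otimes> coord_f X + sl2_h \<otimes> coord_h X" for X :: "'a loop"
    by (simp add: sl2_e_def sl2_f_def sl2_h_def sl2_arith_defs tensor_def)
  define \<phi> where "\<phi> X = \<beta> sl2_e (coord_e X) + \<beta> sl2_f (coord_f X) + \<beta> sl2_h (coord_h X)" for X
  have "Vector_Spaces.linear loop_scale s \<phi>"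
    unfolding Vector_Spaces.linear_iff using vs loop.vector_space_axioms
    by (simp add: \<phi>_def loop_scale_def smul_def plus_sl2_def b2 s.scale_right_distrib)
  moreover have "\<phi> (u \<otimes> a) = \<beta> u a" for u a
    by (subst (2) u_dec) (simp add: \<phi>_def tensor_def b1 b2)
  moreover have "\<phi>' = \<phi>"
    if "Vector_Spaces.linear loop_scale s \<phi>'" and *: "\<forall>u a. \<phi>' (u \<otimes> a) = \<beta> u a" for \<phi>'
  proof
    fix X
    have "\<phi>' (X + Y) = \<phi>' X + \<phi>' Y" for X Y
      using that(1) by (simp add: Vector_Spaces.linear_iff)
    then show "\<phi>' X = \<phi> X"
      by (subst X_dec) (simp add: * \<phi>_def)
  qed
  ultimately show ?thesis by blast
qed


section \<open>The Onsager Lie algebra\<close>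

definition lie_subalgebra :: "'a::field loop set \<Rightarrow> bool" where
  "lie_subalgebra K \<longleftrightarrow> loop.subspace K \<and> (\<forall>X\<in>K. \<forall>Y\<in>K. \<lbrakk>X, Y\<rbrakk> \<in> K)"

definition ons_A :: "'a::field loop" where "ons_A = sl2_x \<otimes> 1"
definition ons_B :: "'a::field loop" where "ons_B = sl2_y \<otimes> tvar + sl2_z \<otimes> (tvar - 1)"

text \<open>The Onsager Lie algebra is identified with its image under the embedding sending the
  generators \<open>A, B\<close> to \<open>ons_A, ons_B\<close>, that is, with the Lie subalgebra these two elements
  generate.\<close>

definition Onsager :: "'a::field loop set" where
  "Onsager = lie_subalgebra hull {ons_A, ons_B}"

definition A_dd :: "nat \<Rightarrow> 'a::field loop" where
  "A_dd i = - (sl2_x \<otimes> (tvar - 1) ^ i)"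

definition B_dd :: "nat \<Rightarrow> 'a::field loop" where
  "B_dd i = (- (sl2_y \<otimes> tvar) - sl2_z \<otimes> (tvar - 1)) \<cdot> (tvar - 1) ^ i"

definition psi_dd :: "nat \<Rightarrow> 'a::field loop" where
  "psi_dd i = (- (sl2_x \<otimes> 1) - sl2_y \<otimes> tvar) \<cdot> tm1_powi (int i - 1)"

text \<open>A family, not merely a set, is a basis: its members must be pairwise distinct.\<close>

definition is_basis :: "('i \<Rightarrow> 'a::field loop) \<Rightarrow> 'a loop set \<Rightarrow> bool" where
  "is_basis b V \<longleftrightarrow> inj b \<and> loop.independent (range b) \<and> loop.span (range b) = V"

datatype basis_index = IdxA nat | IdxB nat | IdxPsi nat

fun onsager_family :: "basis_index \<Rightarrow> 'a::field loop" where
  "onsager_family (IdxA i) = A_dd i"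
| "onsager_family (IdxB i) = B_dd i"
| "onsager_family (IdxPsi i) = psi_dd (i + 1)"

end

theory Submission
  imports Defs
begin

text \<open>Write \<open>s = t - 1\<close>. Each of the three families is a fixed element of the loop algebra
  multiplied by powers of \<open>s\<close>, so the bracket relations reduce to three identities in sl2 over the
  coefficient ring. They show that the span of the family is a Lie subalgebra; conversely, read as
  recursions, they produce every member of the family from \<open>A\<close> and \<open>B\<close>, since 2 and 4 are
  invertible. A linear relation amounts to three polynomials \<open>p, q, r\<close> in \<open>s\<close> with
  \<open>-2p - 2r = 0\<close>, \<open>2t(q + r) = 0\<close> and \<open>p + q + (1 + t)r = 0\<close>, which forces \<open>s r = 0\<close> and hence
  \<open>p = q = r = 0\<close>.\<close>

section \<open>Polynomials in t - 1\<close>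

text \<open>This carries F[s] into the coefficient ring, so that relations in the loop algebra can
  be pulled back to polynomials, where coefficients are available.\<close>

lift_definition poly_tm1 :: "'a::field poly \<Rightarrow> 'a three_pt" is "\<lambda>p. Fract (pcompose p [:-1, 1:]) 1"
  by (metis mult_1_left power_0)

lemma poly_tm1_0 [simp]: "poly_tm1 0 = 0"
  by transfer (simp add: Zero_fract_def)

lemma poly_tm1_1 [simp]: "poly_tm1 1 = 1"
  by transfer (simp add: One_fract_def pcompose_1)

lemma poly_tm1_add: "poly_tm1 (p + q) = poly_tm1 p + poly_tm1 q"
  by transfer (simp add: pcompose_add)

lemma poly_tm1_mult: "poly_tm1 (p * q) = poly_tm1 p * poly_tm1 q"
  by transfer (simp add: pcompose_mult)

lemma poly_tm1_minus: "poly_tm1 (- p) = - poly_tm1 p"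
  by transfer (simp add: pcompose_uminus)

lemma poly_tm1_power: "poly_tm1 (p ^ n) = poly_tm1 p ^ n"
  by (induction n) (simp_all add: poly_tm1_mult)

lemma poly_tm1_const: "poly_tm1 [:c:] = scalar c"
  by transfer simp

lemma poly_tm1_X: "poly_tm1 [:0, 1:] = tvar - 1"
  unfolding tm1_powi_1[symmetric] by transfer (simp add: pcompose_pCons)

lemma poly_tm1_monom: "poly_tm1 (monom c n) = scalar c * (tvar - 1) ^ n"
proof -
  have "monom c n = [:c:] * [:0, 1:] ^ n"
    by (simp add: monom_altdef)
  then show ?thesis
    by (simp only: poly_tm1_mult poly_tm1_power poly_tm1_const poly_tm1_X)
qed

text \<open>Substituting a nonconstant polynomial kills no nonzero polynomial, and polynomials embed
  in their fraction field.\<close>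

lemma poly_tm1_eq_0_iff: "poly_tm1 p = 0 \<longleftrightarrow> p = 0"
proof
  assume "poly_tm1 p = 0"
  then have "pcompose p [:-1, 1:] = 0"
    by transfer (simp add: Zero_fract_def eq_fract)
  then show "p = 0"
    by (rule pcompose_eq_0) simp
qed simp

lemma tm1_powi_of_nat: "tm1_powi (int n) = ((tvar - 1) ^ n :: 'a::field three_pt)"
proof (induction n)
  case (Suc n)
  then show ?case
    using tm1_powi_add[of 1 "int n", where 'a = 'a] by (simp add: tm1_powi_1)
qed (simp add: tm1_powi_0)


section \<open>The Lie bracket on the three families\<close>

text \<open>This is \<open>psi_dd 1\<close>, the member of the psi family that carries exponent
  0.\<close>

definition psi_base :: "'a::field loop" where
  "psi_base = - (sl2_x \<otimes> 1) - sl2_y \<otimes> tvar"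

lemma ons_A_eq: "ons_A = SL2 2 0 (- 1)"
  by (simp add: ons_A_def tensor_def sl2_x_def sl2_e_def sl2_h_def sl2_arith_defs)

lemma ons_B_eq: "ons_B = SL2 0 (- 2 * tvar) (- 1)"
  by (simp add: ons_B_def tensor_def sl2_y_def sl2_z_def sl2_f_def sl2_h_def sl2_arith_defs)

lemma psi_base_eq: "psi_base = SL2 (- 2) (2 * tvar) (1 + tvar)"
  by (simp add: psi_base_def tensor_def sl2_x_def sl2_y_def sl2_e_def sl2_f_def sl2_h_def
      sl2_arith_defs)

lemma A_dd_eq: "A_dd i = smul (tm1_powi (int i)) (- ons_A)"
  by (simp add: A_dd_def ons_A_def tm1_powi_of_nat tensor_def sl2_arith_defs mult.commute)

lemma B_dd_eq: "B_dd i = smul (tm1_powi (int i)) (- ons_B)"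
  by (simp add: B_dd_def ons_B_def tm1_powi_of_nat right_act_def sl2_arith_defs)

lemma psi_dd_eq: "psi_dd i = smul (tm1_powi (int i - 1)) psi_base"
  by (simp add: psi_dd_def psi_base_def right_act_def)

lemma smul_smul: "smul a (smul b X) = smul (a * b) X"
  by (simp add: smul_def mult.assoc)

text \<open>These are the brackets among \<open>psi_dd 1\<close>, \<open>A_dd 0\<close> and
  \<open>B_dd 0\<close>; bilinearity over the coefficient ring gives all others. The factor
  \<open>tm1_powi 1\<close> reflects that psi exponents lag one behind their index.\<close>

lemma bracket_base:
  "\<lbrakk>psi_base, - ons_A\<rbrakk> = smul 2 psi_base + smul (2 * tm1_powi 1) (- ons_A)"
  "\<lbrakk>- ons_B, psi_base\<rbrakk> = smul (2 * tm1_powi 1) (- ons_B) + smul 2 psi_base"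
  "\<lbrakk>- ons_A, - ons_B\<rbrakk> = smul 2 (- ons_A) + smul 2 (- ons_B) - smul 4 psi_base"
  by (simp_all add: ons_A_eq ons_B_eq psi_base_eq tm1_powi_1 sl2_arith_defs algebra_simps)

lemma smul_distrib:
  "smul r (X + Y) = smul r X + smul r Y" "smul r (X - Y) = smul r X - smul r Y"
  by (simp_all add: sl2_arith_defs algebra_simps)

text \<open>Both arguments are multiples of one element over the coefficient ring. The same holds
  for the next two families.\<close>

lemma bracket_A_A: "\<lbrakk>A_dd i, A_dd j\<rbrakk> = 0"
  by (simp add: A_dd_eq bracket_bilinear bracket_alternating) (simp add: smul_def zero_sl2_def)

lemma bracket_B_B: "\<lbrakk>B_dd i, B_dd j\<rbrakk> = 0"
  by (simp add: B_dd_eq bracket_bilinear bracket_alternating) (simp add: smul_def zero_sl2_def)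

lemma bracket_psi_psi: "\<lbrakk>psi_dd i, psi_dd j\<rbrakk> = 0"
  by (simp add: psi_dd_eq bracket_bilinear bracket_alternating) (simp add: smul_def zero_sl2_def)

lemma scalar_four: "scalar 4 = 4"
  using scalar_simps(3)[of 2 2] by simp

lemma bracket_psi_A:
  "\<lbrakk>psi_dd i, A_dd j\<rbrakk> = loop_scale 2 (psi_dd (i + j)) + loop_scale 2 (A_dd (i + j))"
proof -
  \<comment> \<open>The left-hand bracket has the common factor (t-1)^(i-1+j), whose exponent is -1
    for i = j = 0; integer powers cover that case too.\<close>
  have *: "tm1_powi (int (i + j) - 1) = tm1_powi (int i - 1) * tm1_powi (int j)"
    "tm1_powi (int (i + j)) = tm1_powi (int i - 1) * tm1_powi (int j) * tm1_powi 1"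
    unfolding tm1_powi_add[symmetric] by (simp_all add: algebra_simps)
  show ?thesis
    unfolding psi_dd_eq A_dd_eq loop_scale_def *
    by (simp add: bracket_bilinear bracket_base smul_distrib smul_smul mult_ac)
qed

lemma bracket_B_psi:
  "\<lbrakk>B_dd i, psi_dd j\<rbrakk> = loop_scale 2 (B_dd (i + j)) + loop_scale 2 (psi_dd (i + j))"
proof -
  have *: "tm1_powi (int (i + j) - 1) = tm1_powi (int i) * tm1_powi (int j - 1)"
    "tm1_powi (int (i + j)) = tm1_powi (int i) * tm1_powi (int j - 1) * tm1_powi 1"
    unfolding tm1_powi_add[symmetric] by (simp_all add: algebra_simps)
  show ?thesis
    unfolding psi_dd_eq B_dd_eq loop_scale_def *
    by (simp add: bracket_bilinear bracket_base smul_distrib smul_smul mult_ac)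
qed

lemma bracket_A_B:
  "\<lbrakk>A_dd i, B_dd j\<rbrakk> = loop_scale 2 (A_dd (i + j)) + loop_scale 2 (B_dd (i + j))
    - loop_scale 4 (psi_dd (i + j + 1))"
proof -
  \<comment> \<open>The index i+j+1 of psi cancels its shift, so all three terms have exponent
    i+j.\<close>
  have *: "tm1_powi (int (i + j)) = tm1_powi (int i) * tm1_powi (int j)"
    "tm1_powi (int (i + j + 1) - 1) = tm1_powi (int i) * tm1_powi (int j)"
    unfolding tm1_powi_add[symmetric] by (simp_all add: algebra_simps)
  show ?thesis
    unfolding psi_dd_eq A_dd_eq B_dd_eq loop_scale_def *
    by (simp add: bracket_bilinear bracket_base smul_distrib smul_smul mult_ac scalar_four)
qed

lemma A_dd_0: "A_dd 0 = - ons_A"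
  by (simp add: A_dd_eq tm1_powi_0 smul_def)

lemma B_dd_0: "B_dd 0 = - ons_B"
  by (simp add: B_dd_eq tm1_powi_0 smul_def)


section \<open>The family spans the Onsager algebra\<close>

lemma loop_scale_bracket_left: "\<lbrakk>loop_scale c X, Y\<rbrakk> = loop_scale c \<lbrakk>X, Y\<rbrakk>"
  by (simp add: loop_scale_def bracket_bilinear)

lemma loop_scale_bracket_right: "\<lbrakk>X, loop_scale c Y\<rbrakk> = loop_scale c \<lbrakk>X, Y\<rbrakk>"
  by (simp add: loop_scale_def bracket_bilinear)

lemma bracket_zero: "\<lbrakk>0, X\<rbrakk> = 0" "\<lbrakk>X, 0\<rbrakk> = 0"
  by (simp_all add: sl2_arith_defs)

lemma bracket_antisym: "\<lbrakk>Y, X\<rbrakk> = - \<lbrakk>X, Y\<rbrakk>"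
  by (simp add: sl2_arith_defs algebra_simps)

text \<open>Bilinearity in two span inductions: first on the right argument with a generator on the
  left, then on the left argument.\<close>

lemma lie_subalgebra_span:
  assumes "\<And>X Y. X \<in> S \<Longrightarrow> Y \<in> S \<Longrightarrow> \<lbrakk>X, Y\<rbrakk> \<in> loop.span S"
  shows "lie_subalgebra (loop.span S)"
  unfolding lie_subalgebra_def
proof (intro conjI ballI)
  fix X Y assume X: "X \<in> loop.span S" and Y: "Y \<in> loop.span S"
  have right: "\<lbrakk>Z, Y\<rbrakk> \<in> loop.span S" if "Z \<in> S" for Z
    using Y
  proof (induction Y rule: loop.span_induct_alt)
    case base
    then show ?case by (simp add: bracket_zero loop.span_zero)
  next
    case (step c W V)
    then show ?case
      using assms[OF that \<open>W \<in> S\<close>]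
      by (simp add: bracket_bilinear(2) loop_scale_bracket_right loop.span_add loop.span_scale)
  qed
  show "\<lbrakk>X, Y\<rbrakk> \<in> loop.span S"
    using X
  proof (induction X rule: loop.span_induct_alt)
    case base
    then show ?case by (simp add: bracket_zero loop.span_zero)
  next
    case (step c W V)
    then show ?case
      using right[OF \<open>W \<in> S\<close>]
      by (simp add: bracket_bilinear(1) loop_scale_bracket_left loop.span_add loop.span_scale)
  qed
qed (rule loop.subspace_span)

lemma onsager_family_in_span:
  "A_dd i \<in> loop.span (range onsager_family)" "B_dd i \<in> loop.span (range onsager_family)"
  "psi_dd (Suc i) \<in> loop.span (range onsager_family)"
proof -
  have "onsager_family k \<in> loop.span (range onsager_family)" for k
    by (simp add: loop.span_base)
  from this[of "IdxA i"] this[of "IdxB i"] this[of "IdxPsi i"]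
  show "A_dd i \<in> loop.span (range onsager_family)" "B_dd i \<in> loop.span (range onsager_family)"
    "psi_dd (Suc i) \<in> loop.span (range onsager_family)"
    by simp_all
qed

text \<open>Every psi index produced is at least 1: it is either a sum with a positive term or
  i+j+1. Hence \<open>psi_dd 0\<close> never arises.\<close>

lemma lie_subalgebra_span_onsager_family: "lie_subalgebra (loop.span (range onsager_family))"
proof (rule lie_subalgebra_span)
  let ?V = "loop.span (range onsager_family)"
  note in_V = onsager_family_in_span loop.span_add loop.span_diff loop.span_scale loop.span_zero
  \<comment> \<open>The bracket formulas treat one order of each mixed pair; antisymmetry supplies
    the other.\<close>
  have BA: "\<lbrakk>B_dd i, A_dd j\<rbrakk> \<in> ?V" for i j
    by (subst bracket_antisym, rule loop.span_neg) (simp add: bracket_A_B in_V)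
  have A_psi: "\<lbrakk>A_dd i, psi_dd (Suc j)\<rbrakk> \<in> ?V" for i j
    by (subst bracket_antisym, rule loop.span_neg) (simp add: bracket_psi_A in_V)
  have psi_B: "\<lbrakk>psi_dd (Suc i), B_dd j\<rbrakk> \<in> ?V" for i j
    by (subst bracket_antisym, rule loop.span_neg) (simp add: bracket_B_psi in_V)
  have "\<lbrakk>onsager_family k, onsager_family l\<rbrakk> \<in> ?V" for k l
    by (cases k; cases l)
      (simp_all add: BA A_psi psi_B bracket_A_A bracket_B_B bracket_psi_psi bracket_psi_A
        bracket_B_psi bracket_A_B in_V)
  then show "\<lbrakk>X, Y\<rbrakk> \<in> ?V" if "X \<in> range onsager_family" "Y \<in> range onsager_family" for X Y
    using that by blast
qed

section \<open>Generation of the family from A and B\<close>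

lemma subspace_scaleD:
  assumes "loop.subspace K" "loop_scale c X \<in> K" "c \<noteq> 0"
  shows "X \<in> K"
  using loop.subspace_scale[OF assms(1,2), of "inverse c"] assms(3) by simp

text \<open>The recursion alternates: level i of A and B yields \<open>psi_dd (i + 1)\<close>, which
  in turn yields level i+1 of A and B. Characteristic zero permits division by 4 and 2.\<close>

lemma onsager_family_in_lie_subalgebra:
  fixes K :: "'a::field_char_0 loop set"
  assumes K: "lie_subalgebra K" and A: "ons_A \<in> K" and B: "ons_B \<in> K"
  shows "onsager_family k \<in> K"
proof -
  have br: "\<lbrakk>X, Y\<rbrakk> \<in> K" if "X \<in> K" "Y \<in> K" for X Y
    using K that by (auto simp: lie_subalgebra_def)
  have sub: "loop.subspace K"
    using K by (simp add: lie_subalgebra_def)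
  note closed = loop.subspace_add[OF sub] loop.subspace_diff[OF sub] loop.subspace_scale[OF sub]
    loop.subspace_neg[OF sub]
  have A0: "A_dd 0 \<in> K" and B0: "B_dd 0 \<in> K"
    using A B by (simp_all add: A_dd_0 B_dd_0 closed)
  have psi: "psi_dd (i + 1) \<in> K" if "A_dd i \<in> K" "B_dd i \<in> K" for i
  proof -
    have "loop_scale 4 (psi_dd (i + 1))
        = loop_scale 2 (A_dd i) + loop_scale 2 (B_dd i) - \<lbrakk>A_dd i, B_dd 0\<rbrakk>"
      by (simp add: bracket_A_B)
    also have "\<dots> \<in> K"
      using that by (intro closed br B0)
    finally show ?thesis
      by (rule subspace_scaleD[OF sub]) simp
  qed
  have AB: "A_dd i \<in> K \<and> B_dd i \<in> K" for i
  proof (induction i)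
    case 0
    show ?case using A0 B0 by blast
  next
    case (Suc i)
    then have P: "psi_dd (Suc i) \<in> K"
      using psi by simp
    have "loop_scale 2 (A_dd (Suc i)) = \<lbrakk>psi_dd (Suc i), A_dd 0\<rbrakk> - loop_scale 2 (psi_dd (Suc i))"
      by (simp add: bracket_psi_A)
    also have "\<dots> \<in> K"
      by (intro closed br A0 P)
    finally have A: "A_dd (Suc i) \<in> K"
      by (rule subspace_scaleD[OF sub]) simp
    have "loop_scale 2 (B_dd (Suc i)) = \<lbrakk>B_dd 0, psi_dd (Suc i)\<rbrakk> - loop_scale 2 (psi_dd (Suc i))"
      by (simp add: bracket_B_psi)
    also have "\<dots> \<in> K"
      by (intro closed br B0 P)
    finally have "B_dd (Suc i) \<in> K"
      by (rule subspace_scaleD[OF sub]) simp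
    with A show ?case ..
  qed
  show ?thesis
    using AB psi by (cases k) simp_all
qed

lemma span_onsager_family:
  "loop.span (range onsager_family) = (Onsager :: 'a::field_char_0 loop set)"
proof
  show "loop.span (range onsager_family) \<subseteq> (Onsager :: 'a loop set)"
    unfolding Onsager_def hull_def
  proof (rule Inter_greatest)
    fix K :: "'a loop set"
    assume "K \<in> {K. lie_subalgebra K \<and> {ons_A, ons_B} \<subseteq> K}"
    then have "range onsager_family \<subseteq> K" and "loop.subspace K"
      using onsager_family_in_lie_subalgebra[of K] by (auto simp: lie_subalgebra_def)
    then show "loop.span (range onsager_family) \<subseteq> K"
      by (rule loop.span_minimal)
  qed
  have "- A_dd 0 \<in> loop.span (range onsager_family)" "- B_dd 0 \<in> loop.span (range onsager_family)"
    by (intro loop.span_neg onsager_family_in_span)+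
  then have "{ons_A, ons_B} \<subseteq> loop.span (range onsager_family)"
    by (simp add: A_dd_0 B_dd_0)
  then show "(Onsager :: 'a loop set) \<subseteq> loop.span (range onsager_family)"
    unfolding Onsager_def by (rule hull_minimal) (rule lie_subalgebra_span_onsager_family)
qed


section \<open>Linear independence\<close>

text \<open>Coefficients are attached to indices rather than to vectors, so a single hypothesis
  gives both injectivity and independence.\<close>

lemma is_basis_spanI:
  assumes indep: "\<And>S c. finite S \<Longrightarrow> (\<Sum>k\<in>S. loop_scale (c k) (b k)) = 0 \<Longrightarrow> \<forall>k\<in>S. c k = 0"
  shows "is_basis b (loop.span (range b))"
  unfolding is_basis_def
proof (intro conjI refl)
  show inj: "inj b"
  proof (rule injI, rule ccontr)
    fix k l assume "b k = b l" "k \<noteq> l"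
    then show False
      \<comment> \<open>A repeated vector would satisfy the relation with coefficients 1 and
        -1.\<close>
      using indep[of "{k, l}" "\<lambda>m. if m = k then 1 else - 1"] by simp
  qed
  show "loop.independent (range b)"
    unfolding loop.dependent_explicit
  proof clarify
    fix U u v
    assume U: "finite U" "U \<subseteq> range b" and sum: "(\<Sum>X\<in>U. loop_scale (u X) X) = 0"
      and v: "v \<in> U" "u v \<noteq> 0"
    obtain S where S: "U = b ` S"
      using U(2) by (metis subset_imageE)
    have inj_S: "inj_on b S"
      using inj by (rule inj_on_subset) simp
    have "finite S"
      using U(1) inj_S by (simp add: S finite_image_iff)
    moreover have "(\<Sum>k\<in>S. loop_scale (u (b k)) (b k)) = 0"
      using sum by (simp add: S sum.reindex[OF inj_S])
    ultimately have "\<forall>k\<in>S. u (b k) = 0"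
      by (rule indep)
    with v show False
      by (auto simp: S)
  qed
qed

section \<open>Linear relations as triples of polynomials\<close>

definition family_comb :: "'a::field poly \<Rightarrow> 'a poly \<Rightarrow> 'a poly \<Rightarrow> 'a loop" where
  "family_comb p q r =
    smul (poly_tm1 p) (- ons_A) + smul (poly_tm1 q) (- ons_B) + smul (poly_tm1 r) psi_base"

text \<open>In the variable s, t is \<open>[:1, 1:]\<close>, and the factor 1+t of the h-coordinate
  of \<open>psi_base\<close> becomes 2+s.\<close>

lemma family_comb_eq:
  "family_comb p q r = SL2 (poly_tm1 (- 2 * (p + r))) (poly_tm1 (2 * ([:1, 1:] * (q + r))))
    (poly_tm1 (p + q + 2 * r + [:0, 1:] * r))"
proof -
  have two: "poly_tm1 2 = (2 :: 'a three_pt)"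
    using poly_tm1_add[of 1 1] by simp
  have t: "poly_tm1 [:1, 1:] = (tvar :: 'a three_pt)"
    using poly_tm1_add[of 1 "[:0, 1:]"] unfolding poly_tm1_X poly_tm1_1 by (simp add: one_pCons)
  show ?thesis
    by (simp only: family_comb_def ons_A_eq ons_B_eq psi_base_eq sl2_arith_defs sl2.sel
        poly_tm1_mult poly_tm1_add poly_tm1_minus two t poly_tm1_X)
      (simp add: algebra_simps)
qed

lemma family_comb_eq_0:
  fixes p q r :: "'a::field_char_0 poly"
  assumes "family_comb p q r = 0"
  shows "p = 0" "q = 0" "r = 0"
proof -
  have "- 2 * (p + r) = 0" "2 * ([:1, 1:] * (q + r)) = 0" and *: "p + q + 2 * r + [:0, 1:] * r = 0"
    using assms by (simp_all only: family_comb_eq zero_sl2_def sl2.inject poly_tm1_eq_0_iff)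
  then have "p + r = 0" "q + r = 0"
    \<comment> \<open>Polynomials form a domain, and 2 is nonzero in characteristic zero, so both 2
      and t cancel.\<close>
    by (simp_all only: mult_eq_0_iff) simp_all
  then have pq: "p = - r" "q = - r"
    by (simp_all only: eq_neg_iff_add_eq_0)
  with * show "r = 0"
    by simp
  with pq show "p = 0" "q = 0"
    by simp_all
qed

lemma sum_family_comb:
  "(\<Sum>k\<in>S. family_comb (p k) (q k) (r k)) = family_comb (sum p S) (sum q S) (sum r S)"
proof (induction S rule: infinite_finite_induct)
  case (insert k S)
  then show ?case
    by (simp add: family_comb_def poly_tm1_add smul_def plus_sl2_def algebra_simps)
qed (simp_all add: family_comb_def smul_def plus_sl2_def zero_sl2_def)

section \<open>Reading off individual coefficients\<close>

definition coeff_A :: "basis_index \<Rightarrow> 'a::zero \<Rightarrow> 'a poly" where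
  "coeff_A k c = (case k of IdxA i \<Rightarrow> monom c i | _ \<Rightarrow> 0)"

definition coeff_B :: "basis_index \<Rightarrow> 'a::zero \<Rightarrow> 'a poly" where
  "coeff_B k c = (case k of IdxB i \<Rightarrow> monom c i | _ \<Rightarrow> 0)"

definition coeff_psi :: "basis_index \<Rightarrow> 'a::zero \<Rightarrow> 'a poly" where
  "coeff_psi k c = (case k of IdxPsi i \<Rightarrow> monom c i | _ \<Rightarrow> 0)"

text \<open>\<open>IdxPsi i\<close> denotes \<open>psi_dd (i + 1)\<close>, with exponent i; thus the
  index equals the degree of the monomial for all three types.\<close>

lemma loop_scale_onsager_family:
  "loop_scale c (onsager_family k) = family_comb (coeff_A k c) (coeff_B k c) (coeff_psi k c)"
  by (cases k)
    (simp_all add: coeff_A_def coeff_B_def coeff_psi_def family_comb_def A_dd_eq B_dd_eq psi_dd_eq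
      loop_scale_def smul_smul poly_tm1_monom tm1_powi_of_nat smul_def plus_sl2_def)

text \<open>Distinct indices of one type give distinct degrees, so each coefficient receives at most
  one contribution.\<close>

lemma coeff_sum_components:
  assumes "finite S"
  shows "coeff (\<Sum>k\<in>S. coeff_A k (c k)) i = (if IdxA i \<in> S then c (IdxA i) else 0)"
    and "coeff (\<Sum>k\<in>S. coeff_B k (c k)) i = (if IdxB i \<in> S then c (IdxB i) else 0)"
    and "coeff (\<Sum>k\<in>S. coeff_psi k (c k)) i = (if IdxPsi i \<in> S then c (IdxPsi i) else 0)"
proof -
  have "coeff (coeff_A k (c k)) i = (if k = IdxA i then c k else 0)"
    "coeff (coeff_B k (c k)) i = (if k = IdxB i then c k else 0)"
    "coeff (coeff_psi k (c k)) i = (if k = IdxPsi i then c k else 0)" for k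
    by (auto simp: coeff_A_def coeff_B_def coeff_psi_def split: basis_index.split)
  with assms show
    "coeff (\<Sum>k\<in>S. coeff_A k (c k)) i = (if IdxA i \<in> S then c (IdxA i) else 0)"
    "coeff (\<Sum>k\<in>S. coeff_B k (c k)) i = (if IdxB i \<in> S then c (IdxB i) else 0)"
    "coeff (\<Sum>k\<in>S. coeff_psi k (c k)) i = (if IdxPsi i \<in> S then c (IdxPsi i) else 0)"
    by (simp_all add: coeff_sum)
qed

lemma onsager_family_coeffs_zero:
  fixes c :: "basis_index \<Rightarrow> 'a::field_char_0"
  assumes S: "finite S" and sum: "(\<Sum>k\<in>S. loop_scale (c k) (onsager_family k)) = 0"
  shows "\<forall>k\<in>S. c k = 0"
proof
  fix k assume "k \<in> S"
  have zero: "(\<Sum>k\<in>S. coeff_A k (c k)) = 0" "(\<Sum>k\<in>S. coeff_B k (c k)) = 0"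
    "(\<Sum>k\<in>S. coeff_psi k (c k)) = 0"
    \<comment> \<open>The whole relation collapses to one \<open>family_comb\<close> of three summed
      polynomials, each of which must vanish.\<close>
    using family_comb_eq_0 sum unfolding loop_scale_onsager_family sum_family_comb by blast+
  show "c k = 0"
  proof (cases k)
    case (IdxA i)
    then show ?thesis
      using coeff_sum_components(1)[OF S, of c i] zero(1) \<open>k \<in> S\<close> by simp
  next
    case (IdxB i)
    then show ?thesis
      using coeff_sum_components(2)[OF S, of c i] zero(2) \<open>k \<in> S\<close> by simp
  next
    case (IdxPsi i)
    then show ?thesis
      using coeff_sum_components(3)[OF S, of c i] zero(3) \<open>k \<in> S\<close> by simp
  qed
qed

theorem theorem7p3:
  shows "is_basis onsager_family (Onsager :: 'a::field_char_0 loop set) \<and>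
    (A_dd 0 :: 'a loop) = - ons_A \<and>
    (B_dd 0 :: 'a loop) = - ons_B \<and>
    (\<forall>i j.
      \<lbrakk>A_dd i :: 'a loop, A_dd j\<rbrakk> = 0 \<and>
      \<lbrakk>B_dd i :: 'a loop, B_dd j\<rbrakk> = 0 \<and>
      \<lbrakk>psi_dd i :: 'a loop, psi_dd j\<rbrakk> = 0 \<and>
      \<lbrakk>psi_dd i :: 'a loop, A_dd j\<rbrakk> =
        loop_scale 2 (psi_dd (i + j)) + loop_scale 2 (A_dd (i + j)) \<and>
      \<lbrakk>B_dd i :: 'a loop, psi_dd j\<rbrakk> =
        loop_scale 2 (B_dd (i + j)) + loop_scale 2 (psi_dd (i + j)) \<and>
      \<lbrakk>A_dd i :: 'a loop, B_dd j\<rbrakk> =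
        loop_scale 2 (A_dd (i + j)) + loop_scale 2 (B_dd (i + j))
          - loop_scale 4 (psi_dd (i + j + 1)))"
proof -
  have "is_basis onsager_family (Onsager :: 'a loop set)"
    unfolding span_onsager_family[symmetric]
    by (rule is_basis_spanI) (rule onsager_family_coeffs_zero)
  then show ?thesis
    using A_dd_0 B_dd_0 bracket_A_A bracket_B_B bracket_psi_psi bracket_psi_A bracket_B_psi
      bracket_A_B by blast
qed

end
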